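(* Let $n,k$ be positive integers, let $S\subseteq\{0,1,\dots,k-2\}$ be nonempty with $t:=\max(S)$, and let $n\geq\max(3k-2t+1,2k+1)$. Then \[Z(J_S(n,k))\le Z_t(J_S(n,k))\le Z_c(J_S(n,k))\le\binom{n}{k}-\binom{2k-2t}{k-t}.\] If $S=\{0,1,\dots,t\}$, then equality holds throughout.
   Context: For $S\subseteq\{0,1,\dots,k-1\}$, the generalized Johnson graph $J_S(n,k)$ is the simple graph whose vertices are the $k$-element subsets of $\{1,\dots,n\}$, two distinct vertices being adjacent if and only if the size of their intersection lies in $S$. Zero forcing on a graph $G$: start with a set of black vertices, all others white; repeatedly, if a black vertex $v$ has exactly one white neighbor $w$, color $w$ black. A set of initially black vertices is a zero forcing set if this process eventually colors all vertices black. $Z(G)$ is the minimum size of a zero forcing set; $Z_t(G)$ is the minimum size of a zero forcing set $B$ such that the induced subgraph $G[B]$ has no isolated vertices; $Z_c(G)$ is the minimum size of a zero forcing set $B$ such that $G[B]$ is connected. *)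

theory Defs
  imports Complex_Main "Graph_Theory.Graph_Theory" "HOL-Library.Extended_Nat"
begin

text \<open>Simple graphs are finite, symmetric, loop-free digraphs, as in \<^theory>\<open>Graph_Theory.Digraph\<close>.\<close>

definition johnson_graph :: "nat set \<Rightarrow> nat \<Rightarrow> nat \<Rightarrow> nat set pair_pre_digraph" where
  "johnson_graph S n k =
     \<lparr> pverts = {A. A \<subseteq> {1..n} \<and> card A = k},
       parcs = {(A, B). A \<subseteq> {1..n} \<and> card A = k \<and> B \<subseteq> {1..n} \<and> card B = k \<and>
                        A \<noteq> B \<and> card (A \<inter> B) \<in> S} \<rparr>"

lemma pair_graph_johnson_graph: "pair_graph (johnson_graph S n k)"
proof -
  have fin: "finite {A. A \<subseteq> {1..n} \<and> card A = k}"
    by (rule finite_subset[of _ "Pow {1..n}"]) auto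
  have "parcs (johnson_graph S n k) \<subseteq> pverts (johnson_graph S n k) \<times> pverts (johnson_graph S n k)"
    by (auto simp: johnson_graph_def)
  then have fin': "finite (parcs (johnson_graph S n k))"
    by (rule finite_subset) (use fin in \<open>simp add: johnson_graph_def\<close>)
  have sym: "symmetric (with_proj (johnson_graph S n k))"
    unfolding symmetric_def
    by (rule symI) (auto simp: arcs_ends_def arc_to_ends_def with_proj_def johnson_graph_def
        image_iff Int_commute)
  show ?thesis
  proof
    fix e assume e: "e \<in> parcs (johnson_graph S n k)"
    show "fst e \<in> pverts (johnson_graph S n k)" using e by (cases e) (simp add: johnson_graph_def)
    show "snd e \<in> pverts (johnson_graph S n k)" using e by (cases e) (simp add: johnson_graph_def)
    show "fst e \<noteq> snd e" using e by (cases e) (simp add: johnson_graph_def)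
  next
    show "finite (pverts (johnson_graph S n k))" using fin by (simp add: johnson_graph_def)
  qed (fact fin' sym)+
qed

inductive force_step :: "('a, 'b) pre_digraph \<Rightarrow> 'a set \<Rightarrow> 'a set \<Rightarrow> bool" for G where
  "v \<in> B \<Longrightarrow> {u \<in> verts G. v \<rightarrow>\<^bsub>G\<^esub> u \<and> u \<notin> B} = {w} \<Longrightarrow> force_step G B (insert w B)"

definition zero_forcing_set :: "('a, 'b) pre_digraph \<Rightarrow> 'a set \<Rightarrow> bool" where
  "zero_forcing_set G B \<longleftrightarrow> B \<subseteq> verts G \<and> (force_step G)\<^sup>*\<^sup>* B (verts G)"

definition no_isolated_verts :: "('a, 'b) pre_digraph \<Rightarrow> bool" where
  "no_isolated_verts G \<longleftrightarrow> (\<forall>v \<in> verts G. \<exists>w \<in> verts G. v \<rightarrow>\<^bsub>G\<^esub> w)"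

text \<open>
  The minima are taken in \<^typ>\<open>enat\<close>, so that the value is \<^term>\<open>\<infinity>\<close> when no admissible set
  exists; an upper bound by a natural number therefore asserts existence of an admissible set.
\<close>

definition zero_forcing_number :: "('a, 'b) pre_digraph \<Rightarrow> enat" where
  "zero_forcing_number G = (INF B \<in> {B. zero_forcing_set G B}. enat (card B))"

definition total_zero_forcing_number :: "('a, 'b) pre_digraph \<Rightarrow> enat" where
  "total_zero_forcing_number G =
     (INF B \<in> {B. zero_forcing_set G B \<and> no_isolated_verts (G \<restriction> B)}. enat (card B))"

definition connected_zero_forcing_number :: "('a, 'b) pre_digraph \<Rightarrow> enat" where
  "connected_zero_forcing_number G =
     (INF B \<in> {B. zero_forcing_set G B \<and> Digraph_Component.connected (G \<restriction> B)}. enat (card B))"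

end

(*
  Upper bound: put r = k - t. A fixed t-set T is added to every set of a skew Bollobas system of
  pairs of r-sets; a pair of the system with k-sets v, w means that v meets w exactly in T and meets
  every white set coloured later in more than t points, so v forces w. The system is glued from two
  systems on nearly disjoint ground sets Y and Z by means of one extra point p, which makes the
  forcing sets black. The black graph is connected because two k-sets differing by one swap have
  many common neighbours, some of which are black.

  Lower bound for S = {0..t}: attach a generic linear polynomial to every ground element and the
  product of these to every k-set. The t-th subresultant F(v, w) of two such products is nonzero
  iff v and w share at most t elements, that is, iff they are adjacent. As F(v, w) is an
  alternating form in r vectors of dimension 2r depending on v, the matrix F has rank at most
  binom(2r, r) on any set of columns. A vector in its kernel that vanishes on a zero forcing set
  vanishes everywhere, so at most binom(2r, r) vertices lie outside such a set.
*)
theory Submission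
  imports Defs "Jordan_Normal_Form.Determinant" "HOL-Computational_Algebra.Polynomial"
begin

subsection \<open>Spaces of alternating forms\<close>

text \<open>Gaussian elimination, with arbitrary index sets so that equations can be labelled by
  \<open>r\<close>-subsets and unknowns by vertices.\<close>

lemma homogeneous_system_nontrivial:
  fixes a :: "'i \<Rightarrow> 'u \<Rightarrow> 'f::field"
  assumes "finite E" "finite U" "card E < card U"
  shows "\<exists>x. (\<exists>u\<in>U. x u \<noteq> 0) \<and> (\<forall>i\<in>E. (\<Sum>u\<in>U. a i u * x u) = 0)"
  using assms
proof (induction E arbitrary: U a rule: finite_induct)
  case empty
  then have "U \<noteq> {}" by auto
  then show ?case by (intro exI[of _ "\<lambda>_. 1"]) auto
next
  case (insert e E)
  show ?case
  proof (cases "\<forall>u\<in>U. a e u = 0")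
    case True
    have "card E < card U" using insert by simp
    from insert.IH[OF \<open>finite U\<close> this, of a] True show ?thesis by auto
  next
    case False
    then obtain u0 where u0: "u0 \<in> U" "a e u0 \<noteq> 0" by auto
    define U' where "U' = U - {u0}"
    have U: "U = insert u0 U'" "u0 \<notin> U'" "finite U'"
      using u0 insert.prems by (auto simp: U'_def)
    have "card E < card U'" using insert U by simp
    \<comment> \<open>Pivoting on \<open>a e u0\<close> removes the unknown \<open>u0\<close> from
      the other equations; \<open>y\<close> then gives \<open>u0\<close> the value that solves
      equation \<open>e\<close>.\<close>
    from insert.IH[OF \<open>finite U'\<close> this, of "\<lambda>i u. a i u - a i u0 * a e u / a e u0"]
    obtain x where x: "\<exists>u\<in>U'. x u \<noteq> 0"
      "\<And>i. i \<in> E \<Longrightarrow> (\<Sum>u\<in>U'. (a i u - a i u0 * a e u / a e u0) * x u) = 0" by blast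
    define y where "y = x(u0 := - (\<Sum>u\<in>U'. a e u * x u) / a e u0)"
    have y: "(\<Sum>u\<in>U. a i u * y u) = a i u0 * y u0 + (\<Sum>u\<in>U'. a i u * x u)" for i
    proof -
      have "(\<Sum>u\<in>U'. a i u * y u) = (\<Sum>u\<in>U'. a i u * x u)"
        using U by (intro sum.cong) (auto simp: y_def)
      then show ?thesis using U by simp
    qed
    have "(\<Sum>u\<in>U. a i u * y u) = 0" if "i \<in> insert e E" for i
    proof (cases "i = e")
      case True
      then show ?thesis using u0 by (simp add: y, simp add: y_def)
    next
      case False
      then have "(\<Sum>u\<in>U'. (a i u - a i u0 * a e u / a e u0) * x u) = 0" using x that by auto
      moreover have "(\<Sum>u\<in>U'. (a i u - a i u0 * a e u / a e u0) * x u) =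
          (\<Sum>u\<in>U'. a i u * x u) - a i u0 * (\<Sum>u\<in>U'. a e u * x u) / a e u0"
        by (simp add: algebra_simps sum_subtractf sum_distrib_left sum_divide_distrib)
      ultimately show ?thesis by (simp add: y, simp add: y_def)
    qed
    moreover have "\<exists>u\<in>U. y u \<noteq> 0" using x(1) U by (auto simp: y_def)
    ultimately show ?thesis by blast
  qed
qed

text \<open>Laplace expansion, with each cofactor written as a determinant of full size with a unit
  row, so that the next row can be expanded in the same way.\<close>

lemma det_expand_row:
  fixes A :: "'a::comm_ring_1 mat"
  assumes A: "A \<in> carrier_mat n n" and m: "m < n"
  shows "det A = (\<Sum>c<n. A $$ (m,c) *
    det (mat n n (\<lambda>(i,j). if i = m then (if j = c then 1 else 0) else A $$ (i,j))))"
proof -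
  have "det (mat n n (\<lambda>(i,j). if i = m then (if j = c then 1 else 0) else A $$ (i,j)))
      = cofactor A m c" if c: "c < n" for c
  proof -
    let ?M = "mat n n (\<lambda>(i,j). if i = m then (if j = c then 1 else 0) else A $$ (i,j))"
    have "det ?M = (\<Sum>j<n. ?M $$ (m,j) * cofactor ?M m j)"
      by (rule laplace_expansion_row[OF _ m]) simp
    also have "\<dots> = (\<Sum>j<n. if j = c then cofactor ?M m j else 0)"
      using m by (intro sum.cong) auto
    also have "\<dots> = cofactor ?M m c" using c by simp
    also have "mat_delete ?M m c = mat_delete A m c"
      using A m by (intro eq_matI) (auto simp: mat_delete_def)
    then have "cofactor ?M m c = cofactor A m c" by (simp add: cofactor_def)
    finally show ?thesis .
  qed
  then show ?thesis using laplace_expansion_row[OF A m] by simp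
qed

text \<open>Separate arguments for the two blocks exhibit the determinant, for fixed
  \<open>V\<close>, as an alternating form in the rows of \<open>U\<close>.\<close>

definition stack_mat :: "nat \<Rightarrow> nat \<Rightarrow> (nat \<Rightarrow> nat \<Rightarrow> 'a) \<Rightarrow> (nat \<Rightarrow> nat \<Rightarrow> 'a) \<Rightarrow> 'a mat" where
  "stack_mat r d U V = mat d d (\<lambda>(i,j). if i < r then U i j else V (i - r) j)"

lemma stack_mat_carrier [simp]: "stack_mat r d U V \<in> carrier_mat d d"
  by (simp add: stack_mat_def)

definition unit_rows :: "(nat \<Rightarrow> nat) \<Rightarrow> nat \<Rightarrow> nat \<Rightarrow> 'a::zero_neq_one" where
  "unit_rows g i j = (if j = g i then 1 else 0)"

lemma det_stack_mat_unit_rows_not_inj: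
  assumes "r \<le> d" "\<not> inj_on g {..<r}"
  shows "det (stack_mat r d (unit_rows g) V :: 'a::comm_ring_1 mat) = 0"
proof -
  obtain i j where ij: "i < r" "j < r" "i \<noteq> j" "g i = g j"
    using assms(2) by (auto simp: inj_on_def)
  show ?thesis
    by (rule det_identical_rows[of _ d i j])
       (use ij assms(1) in \<open>auto simp: stack_mat_def unit_rows_def\<close>)
qed

text \<open>The matrices differ by a row permutation, whose sign is \<open>s\<close>. As
  \<open>s\<close> does not depend on \<open>V\<close>, it can be pulled out of a sum over many
  \<open>V\<close>.\<close>

lemma det_stack_mat_unit_rows_reorder:
  assumes r: "r \<le> d" and g: "inj_on g {..<r}" and h: "bij_betw h {..<r} (g ` {..<r})"
  shows "\<exists>s. \<forall>V. det (stack_mat r d (unit_rows g) V :: 'a::comm_ring_1 mat)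
             = s * det (stack_mat r d (unit_rows h) V)"
proof -
  define p where "p i = (if i < r then the_inv_into {..<r} h (g i) else i)" for i
  have hinj: "inj_on h {..<r}" and him: "h ` {..<r} = g ` {..<r}"
    using h by (auto simp: bij_betw_def)
  have p1: "p i < r" and p2: "h (p i) = g i" if "i < r" for i
  proof -
    have gi: "g i \<in> h ` {..<r}" using that him by auto
    show "p i < r" using the_inv_into_into[OF hinj gi, of "{..<r}"] that by (simp add: p_def)
    show "h (p i) = g i" using f_the_inv_into_f[OF hinj gi] that by (simp add: p_def)
  qed
  have "inj_on p {..<r}"
  proof (rule inj_onI)
    fix i j assume "i \<in> {..<r}" "j \<in> {..<r}" "p i = p j"
    then show "i = j" using p2[of i] p2[of j] inj_onD[OF g, of i j] by simp
  qed
  moreover from this have "p ` {..<r} = {..<r}"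
    using p1 by (intro endo_inj_surj) auto
  ultimately have "bij_betw p {..<r} {..<r}" by (simp add: bij_betw_def)
  then have "p permutes {..<r}"
    by (rule bij_imp_permutes) (simp add: p_def)
  then have pp: "p permutes {0..<d}"
    by (rule permutes_subset) (use r in auto)
  have "det (stack_mat r d (unit_rows g) V :: 'a mat) = signof p * det (stack_mat r d (unit_rows h) V)"
    for V
  proof -
    let ?H = "stack_mat r d (unit_rows h) V :: 'a mat"
    have "det (mat d d (\<lambda>(i,j). ?H $$ (p i, j))) = signof p * det ?H"
      by (rule det_permute_rows[OF _ pp]) simp
    also have "mat d d (\<lambda>(i,j). ?H $$ (p i, j)) = stack_mat r d (unit_rows g) V"
    proof (rule eq_matI)
      fix i j assume ij: "i < dim_row (stack_mat r d (unit_rows g) V :: 'a mat)"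
        "j < dim_col (stack_mat r d (unit_rows g) V :: 'a mat)"
      then have "i < d" "j < d" by (auto simp: stack_mat_def)
      moreover have "p i < d" using \<open>i < d\<close> p1[of i] r by (cases "i < r") (auto simp: p_def)
      moreover have "\<not> i < r \<Longrightarrow> p i = i" by (simp add: p_def)
      ultimately show "mat d d (\<lambda>(i,j). ?H $$ (p i, j)) $$ (i,j)
          = stack_mat r d (unit_rows g) V $$ (i,j)"
        using p1[of i] p2[of i] by (auto simp: stack_mat_def unit_rows_def)
    qed (auto simp: stack_mat_def)
    finally show ?thesis .
  qed
  then show ?thesis by blast
qed

text \<open>An alternating form is determined by its values on one ordering \<open>h I\<close> of
  each \<open>r\<close>-subset \<open>I\<close> of the unit vectors.\<close>

lemma alternating_form_eq_0I:
  fixes x :: "'u \<Rightarrow> 'a::comm_ring_1"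
  assumes r: "r \<le> d"
    and h: "\<And>I. I \<subseteq> {..<d} \<Longrightarrow> card I = r \<Longrightarrow> bij_betw (h I) {..<r} I"
    and 0: "\<And>I. I \<subseteq> {..<d} \<Longrightarrow> card I = r \<Longrightarrow>
      (\<Sum>u\<in>X. det (stack_mat r d (unit_rows (h I)) (V u)) * x u) = 0"
  shows "(\<Sum>u\<in>X. det (stack_mat r d U (V u)) * x u) = 0"
proof -
  have unit: "(\<Sum>u\<in>X. det (stack_mat r d (unit_rows g) (V u)) * x u) = 0"
    if g: "\<And>i. i < r \<Longrightarrow> g i < d" for g
  proof (cases "inj_on g {..<r}")
    case False
    then show ?thesis by (simp add: det_stack_mat_unit_rows_not_inj[OF r])
  next
    case True
    let ?I = "g ` {..<r}"
    have I: "?I \<subseteq> {..<d}" "card ?I = r" using g True by (auto simp: card_image)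
    obtain s where "\<And>W. det (stack_mat r d (unit_rows g) W :: 'a mat)
             = s * det (stack_mat r d (unit_rows (h ?I)) W)"
      using det_stack_mat_unit_rows_reorder[OF r True h[OF I]] by blast
    then have "(\<Sum>u\<in>X. det (stack_mat r d (unit_rows g) (V u)) * x u)
        = s * (\<Sum>u\<in>X. det (stack_mat r d (unit_rows (h ?I)) (V u)) * x u)"
      by (simp add: sum_distrib_left mult.assoc)
    then show ?thesis using 0[OF I] by simp
  qed
  \<comment> \<open>Unit rows are replaced by rows of \<open>U\<close> one at a time, from the top.
    Expanding row \<open>m\<close> alters \<open>g\<close> at \<open>m\<close>, hence the arbitrary
    \<open>g\<close> in the induction.\<close>
  have "(\<Sum>u\<in>X. det (stack_mat r d (\<lambda>i. if i < m then U i else unit_rows g i) (V u)) * x u) = 0"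
    if "m \<le> r" "\<And>i. i < r \<Longrightarrow> g i < d" for m g
    using that
  proof (induction m arbitrary: g)
    case 0
    then show ?case using unit[of g] by simp
  next
    case (Suc m)
    let ?M = "\<lambda>u. stack_mat r d (\<lambda>i. if i < Suc m then U i else unit_rows g i) (V u)"
    let ?N = "\<lambda>c u. stack_mat r d (\<lambda>i. if i < m then U i else unit_rows (g(m := c)) i) (V u)"
    have m: "m < d" using Suc.prems r by simp
    have eq: "mat d d (\<lambda>(i,j). if i = m then (if j = c then 1 else 0) else ?M u $$ (i,j)) = ?N c u"
      for c u
      using Suc.prems by (intro eq_matI) (auto simp: stack_mat_def unit_rows_def)
    have "det (?M u) = (\<Sum>c<d. U m c * det (?N c u))" for u
    proof -
      have "?M u $$ (m,c) = U m c" if "c < d" for c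
        using that m Suc.prems by (simp add: stack_mat_def)
      then show ?thesis unfolding det_expand_row[of "?M u", OF stack_mat_carrier m] eq by simp
    qed
    then have "(\<Sum>u\<in>X. det (?M u) * x u) = (\<Sum>u\<in>X. \<Sum>c<d. U m c * (det (?N c u) * x u))"
      by (simp add: sum_distrib_right mult.assoc)
    also have "\<dots> = (\<Sum>c<d. U m c * (\<Sum>u\<in>X. det (?N c u) * x u))"
      by (subst sum.swap) (simp add: sum_distrib_left)
    also have "\<dots> = 0"
      using Suc.prems by (intro sum.neutral ballI) (subst Suc.IH, auto)
    finally show ?case .
  qed
  from this[of r "\<lambda>i. i"] r
  have "(\<Sum>u\<in>X. det (stack_mat r d (\<lambda>i. if i < r then U i else unit_rows (\<lambda>i. i) i) (V u)) * x u) = 0"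
    by simp
  moreover have "stack_mat r d (\<lambda>i. if i < r then U i else unit_rows (\<lambda>i. i) i) W = stack_mat r d U W"
    for W by (auto simp: stack_mat_def)
  ultimately show ?thesis by simp
qed

lemma exists_bij_betw_lessThan_card:
  assumes "finite I" shows "\<exists>h. bij_betw h {..<card I} I"
  using ex_bij_betw_nat_finite[OF assms] by (simp add: atLeast0LessThan)

text \<open>Vanishing of the combined form amounts to one linear equation per
  \<open>r\<close>-subset of the columns, and there are more unknowns than such subsets.\<close>

lemma stack_mat_det_nontrivial_kernel:
  fixes V :: "'u \<Rightarrow> nat \<Rightarrow> nat \<Rightarrow> 'a::field"
  assumes r: "r \<le> d" and X: "finite X" "d choose r < card X"
  shows "\<exists>x. (\<exists>u\<in>X. x u \<noteq> 0) \<and> (\<forall>U. (\<Sum>u\<in>X. det (stack_mat r d U (V u)) * x u) = 0)"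
proof -
  define E where "E = {I. I \<subseteq> {..<d} \<and> card I = r}"
  have E: "finite E" "card E = d choose r"
    using n_subsets[of "{..<d}" r] by (auto simp: E_def)
  have "\<forall>I\<in>E. \<exists>h. bij_betw h {..<r} I"
    using exists_bij_betw_lessThan_card finite_subset unfolding E_def by blast
  then obtain h where h: "\<And>I. I \<in> E \<Longrightarrow> bij_betw (h I) {..<r} I" by metis
  obtain x where "\<exists>u\<in>X. x u \<noteq> 0"
    "\<And>I. I \<in> E \<Longrightarrow> (\<Sum>u\<in>X. det (stack_mat r d (unit_rows (h I)) (V u)) * x u) = 0"
    using homogeneous_system_nontrivial[OF E(1) X(1),
        of "\<lambda>I u. det (stack_mat r d (unit_rows (h I)) (V u))"] E(2) X(2) by auto
  then show ?thesis
    using alternating_form_eq_0I[OF r, of h V x X] h unfolding E_def by blast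
qed

subsection \<open>Subresultants of products of generic linear factors\<close>

text \<open>These are the rows of a Sylvester matrix truncated at degree \<open>t\<close>: row
  \<open>i\<close> belongs to the multiple of \<open>P\<close> by the \<open>i\<close>-th power of
  the variable.\<close>

definition shift_coeffs :: "nat \<Rightarrow> 'a::comm_semiring_1 poly \<Rightarrow> nat \<Rightarrow> nat \<Rightarrow> 'a" where
  "shift_coeffs t P i j = coeff (monom 1 i * P) (t + j)"

text \<open>For \<open>P\<close>, \<open>Q\<close> of degree at most \<open>t + r\<close> this is, up to sign, the principal subresultant
  coefficient of order \<open>t\<close>, which vanishes if \<open>P\<close> and \<open>Q\<close> share more than \<open>t\<close> linear factors. It
  is alternating and multilinear in \<open>r\<close> vectors of length \<open>2 r\<close> that depend on \<open>P\<close> only.\<close>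

definition subresultant_det :: "nat \<Rightarrow> nat \<Rightarrow> 'a::comm_ring_1 poly \<Rightarrow> 'a poly \<Rightarrow> 'a" where
  "subresultant_det t r P Q = det (stack_mat r (2 * r) (shift_coeffs t P) (shift_coeffs t Q))"

text \<open>Combining rows with the coefficients of \<open>u\<close> amounts to multiplying
  \<open>P\<close> by \<open>u\<close>; this turns polynomial identities into linear dependences of
  rows.\<close>

lemma sum_shift_coeffs:
  fixes u P :: "'a::comm_ring_1 poly"
  assumes "r > 0" "degree u < r"
  shows "(\<Sum>i<r. shift_coeffs t P i j * coeff u i) = coeff (u * P) (t + j)"
proof -
  have "u = (\<Sum>i\<le>r - 1. monom (coeff u i) i)"
    by (rule poly_as_sum_of_monoms'[symmetric]) (use assms in simp)
  also have "{..r - 1} = {..<r}" using assms by auto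
  finally have "u * P = (\<Sum>i<r. monom (coeff u i) i) * P" by simp
  also have "\<dots> = (\<Sum>i<r. smult (coeff u i) (monom 1 i * P))"
    by (simp add: sum_distrib_right flip: mult_smult_left smult_monom)
       (simp add: smult_monom)
  finally show ?thesis
    by (simp add: coeff_sum shift_coeffs_def mult.commute)
qed

text \<open>The coefficients of \<open>u\<close> and \<open>v\<close> together form a nontrivial
  linear dependence among the rows.\<close>

lemma subresultant_det_eq_0:
  fixes P Q :: "'a::field poly"
  assumes r: "r > 0" and deg: "degree u < r" "degree v < r"
    and uv: "u * P + v * Q = 0" "u \<noteq> 0 \<or> v \<noteq> 0"
  shows "subresultant_det t r P Q = 0"
proof -
  let ?M = "stack_mat r (2 * r) (shift_coeffs t P) (shift_coeffs t Q)"
  define w where "w = vec (2 * r) (\<lambda>i. if i < r then coeff u i else coeff v (i - r))"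
  have split: "(\<Sum>i<2 * r. f i) = (\<Sum>i<r. f i) + (\<Sum>i<r. f (r + i))" for f :: "nat \<Rightarrow> 'a"
    using sum.atLeastLessThan_concat[of 0 r "2 * r" f] sum.shift_bounds_nat_ivl[of f 0 r r]
    by (simp add: lessThan_atLeast0 mult_2 add.commute)
  have "?M\<^sup>T *\<^sub>v w = 0\<^sub>v (2 * r)"
  proof (rule eq_vecI)
    fix j assume "j < dim_vec (0\<^sub>v (2 * r))"
    then have j: "j < 2 * r" by simp
    have "(?M\<^sup>T *\<^sub>v w) $ j = (\<Sum>i<2 * r. ?M $$ (i, j) * w $ i)"
      using j by (simp add: scalar_prod_def w_def stack_mat_def lessThan_atLeast0)
    also have "\<dots> = (\<Sum>i<r. ?M $$ (i, j) * w $ i) + (\<Sum>i<r. ?M $$ (r + i, j) * w $ (r + i))"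
      by (rule split)
    also have "\<dots> = (\<Sum>i<r. shift_coeffs t P i j * coeff u i) + (\<Sum>i<r. shift_coeffs t Q i j * coeff v i)"
      using j by (intro arg_cong2[of _ _ _ _ "(+)"] sum.cong) (auto simp: stack_mat_def w_def)
    also have "\<dots> = coeff (u * P + v * Q) (t + j)"
      using r deg by (simp add: sum_shift_coeffs)
    finally show "(?M\<^sup>T *\<^sub>v w) $ j = 0\<^sub>v (2 * r) $ j" using uv j by simp
  qed (simp add: stack_mat_def)
  moreover have "w \<noteq> 0\<^sub>v (2 * r)"
  proof
    assume "w = 0\<^sub>v (2 * r)"
    then have w: "w $ i = 0" if "i < 2 * r" for i using that by simp
    have "coeff u i = 0" for i
      using w[of i] deg(1) by (cases "i < r") (auto simp: w_def coeff_eq_0)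
    moreover have "coeff v i = 0" for i
      using w[of "r + i"] deg(2) by (cases "i < r") (auto simp: w_def coeff_eq_0)
    ultimately show False using uv(2) by (auto simp: poly_eq_iff)
  qed
  ultimately have "det ?M\<^sup>T = 0"
    by (subst det_0_iff_vec_prod_zero[of _ "2 * r"]) (auto intro!: exI[of _ w] simp: w_def)
  then show ?thesis by (simp add: subresultant_det_def det_transpose[OF stack_mat_carrier])
qed

text \<open>The stacked matrix is the identity: the shifts of the two monomials run through the
  degrees from \<open>t\<close> to \<open>t + 2 * r - 1\<close>.\<close>

lemma subresultant_det_monom:
  "subresultant_det t r (monom 1 t) (monom 1 (t + r)) = (1::'a::comm_ring_1)"
proof -
  have "stack_mat r (2 * r) (shift_coeffs t (monom 1 t)) (shift_coeffs t (monom 1 (t + r)))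
      = (1\<^sub>m (2 * r) :: 'a mat)"
    by (rule eq_matI) (auto simp: stack_mat_def shift_coeffs_def mult_monom)
  then show ?thesis by (simp add: subresultant_det_def)
qed

lemma degree_prod_linear_le:
  assumes "\<And>x. degree (l x :: 'a::comm_ring_1 poly) \<le> 1"
  shows "degree (\<Prod>x\<in>A. l x) \<le> card A"
proof (cases "finite A")
  case True
  have "degree (\<Prod>x\<in>A. l x) \<le> sum (degree \<circ> l) A" by (rule degree_prod_sum_le[OF True])
  also have "\<dots> \<le> (\<Sum>x\<in>A. 1)" using assms by (intro sum_mono) auto
  finally show ?thesis by simp
qed auto

text \<open>Multiplying each product by the factors of the other that it lacks gives a common
  multiple. With more than \<open>t\<close> shared elements, fewer than \<open>r\<close> factors are
  lacking on each side.\<close>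

lemma subresultant_det_prod_eq_0:
  fixes l :: "'x \<Rightarrow> 'a::field poly"
  assumes l: "\<And>x. degree (l x) \<le> 1" and fin: "finite A" "finite B"
    and card: "card A = t + r" "card B = t + r" and r: "r > 0" and int: "card (A \<inter> B) > t"
  shows "subresultant_det t r (\<Prod>x\<in>A. l x) (\<Prod>x\<in>B. l x) = 0"
proof -
  let ?u = "\<Prod>x\<in>B - A. l x" and ?v = "- (\<Prod>x\<in>A - B. l x)"
  have A: "(\<Prod>x\<in>A. l x) = (\<Prod>x\<in>A \<inter> B. l x) * (\<Prod>x\<in>A - B. l x)"
    using prod.Int_Diff[OF fin(1), of l B] by (simp add: mult.commute)
  have B: "(\<Prod>x\<in>B. l x) = (\<Prod>x\<in>A \<inter> B. l x) * (\<Prod>x\<in>B - A. l x)"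
    using prod.Int_Diff[OF fin(2), of l A] by (simp add: mult.commute Int_commute)
  show ?thesis
  proof (cases "?u = 0")
    \<comment> \<open>Some \<open>l x\<close> may be the zero polynomial; the second product is then
      zero and the multipliers \<open>0\<close> and \<open>1\<close> do.\<close>
    case True
    then have "(\<Prod>x\<in>B. l x) = 0" using B by simp
    then show ?thesis using r by (intro subresultant_det_eq_0[of r 0 1]) auto
  next
    case False
    have "card (B - A) = card B - card (A \<inter> B)" "card (A - B) = card A - card (A \<inter> B)"
      using fin by (simp_all add: card_Diff_subset_Int Int_commute)
    then have "card (B - A) < r" "card (A - B) < r" using card int r by auto
    then have "degree ?u < r" "degree ?v < r"
      using degree_prod_linear_le[of l "B - A"] degree_prod_linear_le[of l "A - B"] l
      by auto
    moreover have "?u * (\<Prod>x\<in>A. l x) + ?v * (\<Prod>x\<in>B. l x) = 0"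
      unfolding A B by (simp add: algebra_simps)
    ultimately show ?thesis using False r by (intro subresultant_det_eq_0[of r ?u ?v]) auto
  qed
qed

text \<open>The constant 1 on \<open>A - A0\<close>, which misses \<open>B\<close>, and the variable
  elsewhere turn the products into powers of the variable with exponents \<open>t\<close> and
  \<open>t + r\<close>.\<close>

lemma subresultant_det_prod_witness:
  fixes A B :: "'x set"
  assumes fin: "finite A" "finite B"
    and card: "card A = t + r" "card B = t + r" and int: "card (A \<inter> B) \<le> t"
  shows "\<exists>l :: 'x \<Rightarrow> 'a::comm_ring_1 poly. (\<forall>x. degree (l x) \<le> 1) \<and>
    subresultant_det t r (\<Prod>x\<in>A. l x) (\<Prod>x\<in>B. l x) \<noteq> 0"
proof -
  obtain A0 where A0: "A \<inter> B \<subseteq> A0" "A0 \<subseteq> A" "card A0 = t"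
    using exists_subset_between[of "A \<inter> B" t A] card fin int by auto
  define l :: "'x \<Rightarrow> 'a poly" where "l x = (if x \<in> A - A0 then 1 else monom 1 1)" for x
  have "(\<Prod>x\<in>A. l x) = (\<Prod>x\<in>A0. l x)"
    using A0 fin by (intro prod.mono_neutral_right) (auto simp: l_def)
  also have "\<dots> = (\<Prod>x\<in>A0. monom 1 1)" by (intro prod.cong) (auto simp: l_def)
  finally have A: "(\<Prod>x\<in>A. l x) = monom 1 t" by (simp add: A0 monom_power)
  have "(\<Prod>x\<in>B. l x) = (\<Prod>x\<in>B. monom 1 1)"
    using A0 by (intro prod.cong) (auto simp: l_def)
  then have B: "(\<Prod>x\<in>B. l x) = monom 1 (t + r)" by (simp add: card monom_power)
  show ?thesis
    by (intro exI[of _ l]) (auto simp: A B subresultant_det_monom, auto simp: l_def degree_monom_eq)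
qed

section \<open>Polynomial dependence on a parameter, and genericity\<close>

definition polynomial_fun :: "(real \<Rightarrow> real) \<Rightarrow> bool" where
  "polynomial_fun f \<longleftrightarrow> (\<exists>q. \<forall>s. f s = poly q s)"

lemma polynomial_fun_const: "polynomial_fun (\<lambda>_. c)"
  unfolding polynomial_fun_def by (rule exI[of _ "[:c:]"]) simp

lemma polynomial_fun_id: "polynomial_fun (\<lambda>s. s)"
  unfolding polynomial_fun_def by (rule exI[of _ "[:0, 1:]"]) simp

lemma polynomial_fun_add:
  "polynomial_fun f \<Longrightarrow> polynomial_fun g \<Longrightarrow> polynomial_fun (\<lambda>s. f s + g s)"
  unfolding polynomial_fun_def by (metis poly_add)

lemma polynomial_fun_mult:
  "polynomial_fun f \<Longrightarrow> polynomial_fun g \<Longrightarrow> polynomial_fun (\<lambda>s. f s * g s)"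
  unfolding polynomial_fun_def by (metis poly_mult)

lemma polynomial_fun_sum:
  "(\<And>i. i \<in> I \<Longrightarrow> polynomial_fun (f i)) \<Longrightarrow> polynomial_fun (\<lambda>s. \<Sum>i\<in>I. f i s)"
  by (induction I rule: infinite_finite_induct) (auto intro: polynomial_fun_const polynomial_fun_add)

lemma polynomial_fun_prod:
  "(\<And>i. i \<in> I \<Longrightarrow> polynomial_fun (f i)) \<Longrightarrow> polynomial_fun (\<lambda>s. \<Prod>i\<in>I. f i s)"
  by (induction I rule: infinite_finite_induct) (auto intro: polynomial_fun_const polynomial_fun_mult)

lemmas polynomial_fun_intros =
  polynomial_fun_const polynomial_fun_id polynomial_fun_add polynomial_fun_mult
  polynomial_fun_sum polynomial_fun_prod

lemma finite_zeros_polynomial_fun: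
  assumes "polynomial_fun f" "f a \<noteq> 0"
  shows "finite {s. f s = 0}"
proof -
  obtain q where q: "\<And>s. f s = poly q s" using assms(1) by (auto simp: polynomial_fun_def)
  then have "q \<noteq> 0" using assms(2) by auto
  then show ?thesis by (simp add: q poly_roots_finite)
qed

definition line :: "('x \<Rightarrow> real poly) \<Rightarrow> ('x \<Rightarrow> real poly) \<Rightarrow> real \<Rightarrow> 'x \<Rightarrow> real poly" where
  "line l m s x = l x + smult s (m x - l x)"

lemma line_0 [simp]: "line l m 0 = l" and line_1 [simp]: "line l m 1 = m"
  by (auto simp: line_def)

lemma degree_line_le:
  "degree (l x) \<le> d \<Longrightarrow> degree (m x) \<le> d \<Longrightarrow> degree (line l m s x) \<le> d"
  unfolding line_def
  by (intro degree_add_le order.trans[OF degree_smult_le] degree_diff_le) auto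

lemma polynomial_fun_coeff_prod_line:
  "polynomial_fun (\<lambda>s. coeff (\<Prod>x\<in>A. line l m s x) j)"
proof (induction A arbitrary: j rule: infinite_finite_induct)
  case (insert x A)
  then show ?case
    unfolding prod.insert[OF insert.hyps] coeff_mult
    by (auto simp: line_def[of l m _ x] diff_conv_add_uminus simp del: add_uminus_conv_diff
        intro!: polynomial_fun_intros)
qed (auto intro: polynomial_fun_const)

text \<open>By the Leibniz formula the determinant is a finite sum of products of entries, each
  polynomial in \<open>s\<close>.\<close>

lemma polynomial_fun_subresultant_det_line:
  "polynomial_fun (\<lambda>s. subresultant_det t r (\<Prod>x\<in>A. line l m s x) (\<Prod>x\<in>B. line l m s x))"
proof -
  have "polynomial_fun (\<lambda>s. shift_coeffs t (\<Prod>x\<in>A. line l m s x) i j)" for A i j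
    unfolding shift_coeffs_def coeff_mult
    by (intro polynomial_fun_intros polynomial_fun_coeff_prod_line)
  then have "polynomial_fun (\<lambda>s. stack_mat r (2 * r) (shift_coeffs t (\<Prod>x\<in>A. line l m s x))
      (shift_coeffs t (\<Prod>x\<in>B. line l m s x)) $$ (i, j))" if "i < 2 * r" "j < 2 * r" for i j
    using that by (cases "i < r") (auto simp: stack_mat_def)
  then show ?thesis
    unfolding subresultant_det_def det_def'[OF stack_mat_carrier]
    by (intro polynomial_fun_intros) (auto dest: permutes_in_image)
qed

text \<open>Moving along the line from a good choice for all earlier pairs to a good choice for the new
  pair, only finitely many parameters are bad.\<close>

lemma generic_linear_factors:
  fixes F :: "('x set \<times> 'x set) set"
  assumes "finite F"
    and "\<And>A B. (A, B) \<in> F \<Longrightarrow> finite A \<and> finite B \<and> card A = t + r \<and> card B = t + r \<and> card (A \<inter> B) \<le> t"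
  shows "\<exists>l :: 'x \<Rightarrow> real poly. (\<forall>x. degree (l x) \<le> 1) \<and>
    (\<forall>(A, B)\<in>F. subresultant_det t r (\<Prod>x\<in>A. l x) (\<Prod>x\<in>B. l x) \<noteq> 0)"
  using assms
proof (induction F rule: finite_induct)
  case empty
  show ?case by (intro exI[of _ "\<lambda>_. 0"]) auto
next
  case (insert e F)
  obtain A0 B0 where e: "e = (A0, B0)" by (cases e)
  define f where "f = (\<lambda>(A :: 'x set, B :: 'x set) l. subresultant_det t r (\<Prod>x\<in>A. l x) (\<Prod>x\<in>B. l x :: real poly))"
  obtain l where l: "\<And>x. degree (l x) \<le> 1" "\<And>g. g \<in> F \<Longrightarrow> f g l \<noteq> 0"
    using insert.IH insert.prems unfolding f_def by fastforce
  obtain m where m: "\<And>x. degree (m x) \<le> 1" "f e m \<noteq> 0"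
    using subresultant_det_prod_witness[of A0 B0 t r, where 'a = real] insert.prems[of A0 B0]
    unfolding f_def e by auto
  have pf: "polynomial_fun (\<lambda>s. f g (line l m s))" for g
    using polynomial_fun_subresultant_det_line unfolding f_def by (cases g) simp
  have "finite {s. f g (line l m s) = 0}" if "g \<in> insert e F" for g
  proof (cases "g = e")
    case True
    show ?thesis by (rule finite_zeros_polynomial_fun[OF pf, where a = 1]) (use True m in simp)
  next
    case False
    show ?thesis by (rule finite_zeros_polynomial_fun[OF pf, where a = 0]) (use False that l in simp)
  qed
  then have "finite (\<Union>g\<in>insert e F. {s. f g (line l m s) = 0})"
    using insert.hyps by blast
  then obtain s where "s \<notin> (\<Union>g\<in>insert e F. {s. f g (line l m s) = 0})"
    using ex_new_if_finite infinite_UNIV_char_0 by blast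
  then have "\<forall>g\<in>insert e F. f g (line l m s) \<noteq> 0" by blast
  moreover have "\<forall>x. degree (line l m s x) \<le> 1" using l(1) m(1) by (simp add: degree_line_le)
  ultimately show ?case unfolding f_def by (intro exI[of _ "line l m s"]) auto
qed

subsection \<open>The lower bound\<close>

text \<open>When \<open>v\<close> forces \<open>w\<close>, the kernel equation at \<open>v\<close>
  retains only the term \<open>F v w * x w\<close>: non-neighbours of \<open>v\<close> have
  coefficient 0, and the other neighbours are already black, where \<open>x\<close>
  vanishes.\<close>

lemma zero_forcing_kernel_trivial:
  fixes F :: "'a \<Rightarrow> 'a \<Rightarrow> 'f::idom"
  assumes zf: "zero_forcing_set G B" and fin: "finite (verts G)"
    and F: "\<And>v u. v \<in> verts G \<Longrightarrow> u \<in> verts G \<Longrightarrow> F v u \<noteq> 0 \<longleftrightarrow> v \<rightarrow>\<^bsub>G\<^esub> u"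
    and ker: "\<And>v. v \<in> verts G \<Longrightarrow> (\<Sum>u\<in>verts G. F v u * x u) = 0"
    and B: "\<And>u. u \<in> B \<Longrightarrow> x u = 0" and u: "u \<in> verts G"
  shows "x u = 0"
proof -
  have "C \<subseteq> verts G \<and> (\<forall>u\<in>C. x u = 0)" if "(force_step G)\<^sup>*\<^sup>* B C" for C
    using that
  proof (induction rule: rtranclp_induct)
    case base
    then show ?case using zf B by (auto simp: zero_forcing_set_def)
  next
    case (step C D)
    from step.hyps(2) obtain v w where v: "v \<in> C" and D: "D = insert w C"
      and w: "{u \<in> verts G. v \<rightarrow>\<^bsub>G\<^esub> u \<and> u \<notin> C} = {w}"
      by (auto elim: force_step.cases)
    have vG: "v \<in> verts G" and wG: "w \<in> verts G" and vw: "v \<rightarrow>\<^bsub>G\<^esub> w"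
      using v w step.IH by auto
    have "F v u * x u = 0" if "u \<in> verts G - {w}" for u
      using that w step.IH F[OF vG, of u] by auto
    then have "(\<Sum>u\<in>verts G - {w}. F v u * x u) = 0" by (intro sum.neutral) blast
    then have "(\<Sum>u\<in>verts G. F v u * x u) = F v w * x w"
      using fin wG by (simp add: sum.remove)
    then have "x w = 0" using ker[OF vG] F[OF vG wG] vw by simp
    then show ?case using step.IH D wG by auto
  qed
  then show ?thesis using zf u by (auto simp: zero_forcing_set_def)
qed

lemma card_zero_forcing_set_johnson_ge:
  assumes tk: "t < k" and zf: "zero_forcing_set (with_proj (johnson_graph {0..t} n k)) B"
  shows "n choose k \<le> card B + ((2 * k - 2 * t) choose (k - t))"
proof (rule ccontr)
  assume neg: "\<not> ?thesis"
  define r where "r = k - t"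
  have r: "r > 0" "k = t + r" "2 * k - 2 * t = 2 * r" using tk by (auto simp: r_def)
  define V where "V = {A. A \<subseteq> {1..n} \<and> card A = k}"
  have V: "finite V" "card V = n choose k" using n_subsets[of "{1..n}" k] by (auto simp: V_def)
  have finV: "finite A" "card A = t + r" if "A \<in> V" for A
    using that r by (auto simp: V_def intro: finite_subset)
  let ?G = "with_proj (johnson_graph {0..t} n k)"
  have vertsG: "verts ?G = V" by (simp add: johnson_graph_def V_def)
  \<comment> \<open>As \<open>t < k\<close>, a \<open>k\<close>-set meets itself in more than
    \<open>t\<close> elements, so the criterion is right for \<open>u = v\<close> too.\<close>
  have arcs: "u \<rightarrow>\<^bsub>?G\<^esub> v \<longleftrightarrow> card (u \<inter> v) \<le> t" if "u \<in> V" "v \<in> V" for u v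
    using that tk by (auto simp: johnson_graph_def V_def)
  have BV: "B \<subseteq> V" using zf vertsG by (simp add: zero_forcing_set_def)
  let ?F = "{(u, v). u \<in> V \<and> v \<in> V \<and> card (u \<inter> v) \<le> t}"
  have "finite ?F" by (rule finite_subset[of _ "V \<times> V"]) (use V in auto)
  then obtain l :: "nat \<Rightarrow> real poly" where deg: "\<And>x. degree (l x) \<le> 1"
    and l: "\<And>u v. u \<in> V \<Longrightarrow> v \<in> V \<Longrightarrow> card (u \<inter> v) \<le> t \<Longrightarrow>
      subresultant_det t r (\<Prod>x\<in>u. l x) (\<Prod>x\<in>v. l x) \<noteq> 0"
    using generic_linear_factors[of ?F t r] finV by fastforce
  have F: "subresultant_det t r (\<Prod>x\<in>u. l x) (\<Prod>x\<in>v. l x) \<noteq> 0 \<longleftrightarrow> u \<rightarrow>\<^bsub>?G\<^esub> v"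
    if "u \<in> V" "v \<in> V" for u v
  proof (cases "card (u \<inter> v) \<le> t")
    case True
    then show ?thesis using l arcs that by simp
  next
    case False
    then have "subresultant_det t r (\<Prod>x\<in>u. l x) (\<Prod>x\<in>v. l x) = 0"
      using that finV deg r by (intro subresultant_det_prod_eq_0) auto
    then show ?thesis using arcs[OF that] False by simp
  qed
  have "card (V - B) = card V - card B" using BV V by (simp add: card_Diff_subset finite_subset)
  then have "(2 * r) choose r < card (V - B)" using neg V(2) unfolding r(3) r_def[symmetric] by linarith
  then obtain x where x: "\<exists>u\<in>V - B. x u \<noteq> 0"
    "\<And>U. (\<Sum>u\<in>V - B. det (stack_mat r (2 * r) U (shift_coeffs t (\<Prod>x\<in>u. l x))) * x u) = 0"
    using stack_mat_det_nontrivial_kernel[of r "2 * r" "V - B" "\<lambda>u. shift_coeffs t (\<Prod>x\<in>u. l x)"] V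
    by auto
  \<comment> \<open>Extension by zero turns \<open>x\<close> into a kernel vector of the full matrix
    that vanishes on \<open>B\<close>.\<close>
  define y where "y u = (if u \<in> V - B then x u else 0)" for u
  have "(\<Sum>u\<in>V. subresultant_det t r (\<Prod>x\<in>v. l x) (\<Prod>x\<in>u. l x) * y u) = 0" for v
  proof -
    have "(\<Sum>u\<in>V. subresultant_det t r (\<Prod>x\<in>v. l x) (\<Prod>x\<in>u. l x) * y u)
        = (\<Sum>u\<in>V - B. subresultant_det t r (\<Prod>x\<in>v. l x) (\<Prod>x\<in>u. l x) * x u)"
      using V by (intro sum.mono_neutral_cong_right) (auto simp: y_def)
    then show ?thesis using x(2) by (simp add: subresultant_det_def)
  qed
  then have "y u = 0" if "u \<in> V" for u
    using zero_forcing_kernel_trivial[OF zf, of "\<lambda>v u. subresultant_det t r (\<Prod>x\<in>v. l x) (\<Prod>x\<in>u. l x)" y u]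
      F V(1) that unfolding vertsG by (simp add: y_def)
  then show False using x(1) unfolding y_def by (metis DiffD1)
qed

subsection \<open>The upper bound\<close>

text \<open>Simultaneous forces can be carried out one by one: the forcer of \<open>w\<close> has
  \<open>w\<close> as its only neighbour outside \<open>C\<close>, and this survives the colouring
  of other members of \<open>U\<close>.\<close>

lemma force_steps_Un:
  assumes "finite U" "U \<inter> C = {}"
    and "\<And>w. w \<in> U \<Longrightarrow> \<exists>v\<in>C. {u \<in> verts G. v \<rightarrow>\<^bsub>G\<^esub> u \<and> u \<notin> C} = {w}"
  shows "(force_step G)\<^sup>*\<^sup>* C (C \<union> U)"
  using assms
proof (induction U rule: finite_induct)
  case (insert w U)
  obtain v where v: "v \<in> C" "{u \<in> verts G. v \<rightarrow>\<^bsub>G\<^esub> u \<and> u \<notin> C} = {w}"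
    using insert.prems(2)[of w] by blast
  have "{u \<in> verts G. v \<rightarrow>\<^bsub>G\<^esub> u \<and> u \<notin> C \<union> U} = {u \<in> verts G. v \<rightarrow>\<^bsub>G\<^esub> u \<and> u \<notin> C} - U" by auto
  also have "\<dots> = {w}" using v(2) insert.hyps by auto
  finally have "force_step G (C \<union> U) (insert w (C \<union> U))"
    using v(1) by (intro force_step.intros) auto
  moreover have "(force_step G)\<^sup>*\<^sup>* C (C \<union> U)" using insert by auto
  ultimately show ?case by (simp add: rtranclp.rtrancl_into_rtrancl)
qed simp

text \<open>Swapping an element of \<open>u - v\<close> for one of \<open>v - u\<close> stays
  between \<open>D\<close> and \<open>E\<close> and shrinks \<open>u - v\<close>.\<close>

lemma rtrancl_if_swaps_rtrancl:
  assumes "finite E"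
    and swap: "\<And>u v. D \<subseteq> u \<Longrightarrow> u \<subseteq> E \<Longrightarrow> D \<subseteq> v \<Longrightarrow> v \<subseteq> E \<Longrightarrow> card u = k \<Longrightarrow> card v = k \<Longrightarrow>
      card (u \<inter> v) = k - 1 \<Longrightarrow> (u, v) \<in> R\<^sup>*"
    and "D \<subseteq> u" "u \<subseteq> E" "D \<subseteq> v" "v \<subseteq> E" "card u = k" "card v = k"
  shows "(u, v) \<in> R\<^sup>*"
  using assms(3-)
proof (induction "card (u - v)" arbitrary: u rule: less_induct)
  case less
  have fin: "finite u" "finite v" using less.prems assms(1) finite_subset by blast+
  show ?case
  proof (cases "u = v")
    case False
    have "\<not> u \<subseteq> v" using False fin less.prems by (metis card_subset_eq)
    moreover have "\<not> v \<subseteq> u" using False fin less.prems by (metis card_subset_eq)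
    ultimately obtain a b where a: "a \<in> u" "a \<notin> v" and b: "b \<in> v" "b \<notin> u" by auto
    let ?u = "insert b (u - {a})"
    have k: "card ?u = k" using a b fin less.prems card_Suc_Diff1[of u a] by simp
    have "u \<inter> ?u = u - {a}" using b by auto
    then have "card (u \<inter> ?u) = k - 1" using a fin less.prems by simp
    then have "(u, ?u) \<in> R\<^sup>*"
      using less.prems a b k by (intro swap) auto
    moreover have "?u - v = u - v - {a}" using b by auto
    then have "card (?u - v) < card (u - v)"
      using a fin by (simp add: card_Diff1_less del: card_Diff_insert)
    then have "(?u, v) \<in> R\<^sup>*"
      using less.prems a b k by (intro less.hyps) auto
    ultimately show ?thesis by (rule rtrancl_trans)
  qed simp
qed

text \<open>The sets in \<open>W\<^sub>1\<close> are forced by sets containing \<open>p\<close> and the sets in \<open>W\<^sub>2\<close> by sets avoiding \<open>p\<close>, so a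
  forcing set can be white only if it forces in the first round and lies in \<open>W\<^sub>2\<close>. Its part in
  \<open>Y\<close> has \<open>r - 1\<close> elements, so \<open>card (Y \<inter> Z) = r - 2\<close> rules this out.\<close>

locale johnson_construction =
  fixes n k t r :: nat and S T Y Z :: "nat set" and p :: nat
  assumes r: "r \<ge> 2" and k: "k = t + r" and tS: "t \<in> S" and S_le: "\<And>s. s \<in> S \<Longrightarrow> s \<le> t"
    and sub: "T \<subseteq> {1..n}" "p \<in> {1..n}" "Y \<subseteq> {1..n}" "Z \<subseteq> {1..n}"
    and T: "card T = t" "p \<notin> T" "T \<inter> Y = {}" "T \<inter> Z = {}"
    and Y: "card Y = 2 * r - 1" "p \<notin> Y"
    and Z: "card Z = 2 * r - 1" "p \<notin> Z"
    and YZ: "card (Y \<inter> Z) = r - 2"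
    and n: "n \<ge> t + 3 * r + 1" "n \<ge> 2 * k + 1"
begin

section \<open>The white sets and their forcers\<close>

definition "V = {A. A \<subseteq> {1..n} \<and> card A = k}"
definition "W\<^sub>1 = (\<lambda>X. T \<union> X) ` {X. X \<subseteq> Y \<and> card X = r}"
definition "W\<^sub>2 = (\<lambda>X. insert p (T \<union> X)) ` {X. X \<subseteq> Z \<and> card X = r - 1}"
definition "B = V - (W\<^sub>1 \<union> W\<^sub>2)"

abbreviation "G \<equiv> with_proj (johnson_graph S n k)"

lemma finite_sets [simp]: "finite T" "finite Y" "finite Z"
  using sub by (auto intro: finite_subset)

lemma finite_V: "finite V" unfolding V_def by simp

lemma finite_in_V: "A \<in> V \<Longrightarrow> finite A"
  by (auto simp: V_def intro: finite_subset)

lemma verts_G: "verts G = V" and pverts_G [simp]: "pverts (johnson_graph S n k) = V"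
  by (simp_all add: johnson_graph_def V_def)

lemma arc_G: "u \<in> V \<Longrightarrow> v \<in> V \<Longrightarrow> u \<rightarrow>\<^bsub>G\<^esub> v \<longleftrightarrow> card (u \<inter> v) \<in> S"
proof -
  have "k \<notin> S" using S_le[of k] r k by auto
  then show "u \<in> V \<Longrightarrow> v \<in> V \<Longrightarrow> u \<rightarrow>\<^bsub>G\<^esub> v \<longleftrightarrow> card (u \<inter> v) \<in> S"
    by (auto simp: johnson_graph_def V_def)
qed

lemma arc_G_sym: "u \<rightarrow>\<^bsub>G\<^esub> v \<Longrightarrow> v \<rightarrow>\<^bsub>G\<^esub> u"
  by (auto simp: johnson_graph_def Int_commute)

lemma disjoint_union_in_V:
  assumes "A \<subseteq> {1..n}" "C \<subseteq> {1..n}" "A \<inter> C = {}" "card A + card C = k"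
  shows "A \<union> C \<in> V"
proof -
  have "finite A" "finite C" using assms by (auto intro: finite_subset)
  then show ?thesis using assms by (simp add: V_def card_Un_disjoint)
qed

lemma insert_p_in_V:
  assumes "X \<subseteq> {1..n}" "X \<inter> T = {}" "p \<notin> X" "card X = r - 1"
  shows "insert p (T \<union> X) \<in> V"
proof -
  have "finite X" using assms by (auto intro: finite_subset)
  then have "T \<union> insert p X \<in> V"
    using assms T sub r k by (intro disjoint_union_in_V) auto
  then show ?thesis by simp
qed

lemma W1_sub: "W\<^sub>1 \<subseteq> V"
proof -
  have "T \<union> X \<in> V" if "X \<subseteq> Y" "card X = r" for X
    using that T sub k by (intro disjoint_union_in_V) auto
  then show ?thesis by (auto simp: W\<^sub>1_def)
qed

lemma W2_sub: "W\<^sub>2 \<subseteq> V"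
proof -
  have "insert p (T \<union> X) \<in> V" if "X \<subseteq> Z" "card X = r - 1" for X
    using that T sub Z by (intro insert_p_in_V) auto
  then show ?thesis by (auto simp: W\<^sub>2_def)
qed

lemma p_notin_W1: "w \<in> W\<^sub>1 \<Longrightarrow> p \<notin> w" and p_in_W2: "w \<in> W\<^sub>2 \<Longrightarrow> p \<in> w"
  using T Y by (auto simp: W\<^sub>1_def W\<^sub>2_def)

text \<open>Pascal's rule, splitting the white sets by whether they contain
  \<open>p\<close>.\<close>

lemma card_white: "card (W\<^sub>1 \<union> W\<^sub>2) = (2 * r) choose r"
proof -
  have inj1: "inj_on (\<lambda>X. T \<union> X) {X. X \<subseteq> Y \<and> card X = r}"
    by (rule inj_on_inverseI[where g = "\<lambda>A. A - T"]) (use T in auto)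
  have inj2: "inj_on (\<lambda>X. insert p (T \<union> X)) {X. X \<subseteq> Z \<and> card X = r - 1}"
    by (rule inj_on_inverseI[where g = "\<lambda>A. A - insert p T"]) (use T Z in auto)
  have "card W\<^sub>1 = (2 * r - 1) choose r" "card W\<^sub>2 = (2 * r - 1) choose (r - 1)"
    unfolding W\<^sub>1_def W\<^sub>2_def card_image[OF inj1] card_image[OF inj2]
    using Y Z by (simp_all add: n_subsets)
  moreover have "W\<^sub>1 \<inter> W\<^sub>2 = {}" using p_notin_W1 p_in_W2 by blast
  moreover have "finite W\<^sub>1" "finite W\<^sub>2"
    using W1_sub W2_sub finite_V by (auto intro: finite_subset)
  moreover have "(2 * r) choose r = ((2 * r - 1) choose (r - 1)) + ((2 * r - 1) choose r)"
    using r by (cases r) (auto simp: numeral_eq_Suc)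
  ultimately show ?thesis by (simp add: card_Un_disjoint)
qed

text \<open>No element of \<open>S\<close> exceeds \<open>t\<close>, so one common element beyond
  \<open>T\<close> excludes adjacency.\<close>

lemma not_arc_if_meets:
  assumes "v \<in> V" "w \<in> V" "T \<subseteq> v" "T \<subseteq> w" "a \<in> v \<inter> w" "a \<notin> T"
  shows "\<not> v \<rightarrow>\<^bsub>G\<^esub> w"
proof -
  have "card (insert a T) \<le> card (v \<inter> w)"
    using assms finite_in_V by (intro card_mono) auto
  then have "card (v \<inter> w) > t" using T assms by simp
  then show ?thesis using arc_G assms S_le by (meson leD)
qed

lemma arc_if_disjoint:
  assumes "v \<in> V" "w \<in> V" "v \<inter> w = T"
  shows "v \<rightarrow>\<^bsub>G\<^esub> w"
  using assms arc_G T tS by simp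

lemma force_W1:
  assumes w: "w \<in> W\<^sub>1"
  shows "\<exists>v\<in>B. {u \<in> verts G. v \<rightarrow>\<^bsub>G\<^esub> u \<and> u \<notin> B} = {w}"
proof -
  obtain X where X: "X \<subseteq> Y" "card X = r" "w = T \<union> X" using w by (auto simp: W\<^sub>1_def)
  have finX: "finite X" using X finite_sets by (metis finite_subset)
  \<comment> \<open>The complement of \<open>X\<close> in \<open>Y\<close> meets every other
    \<open>r\<close>-subset of \<open>Y\<close>, and \<open>p\<close> lies in every set of
    \<open>W\<^sub>2\<close>; so \<open>w\<close> is the only white neighbour.\<close>
  define v where "v = insert p (T \<union> (Y - X))"
  have cYX: "card (Y - X) = r - 1" using X Y finX by (simp add: card_Diff_subset)
  have v: "v \<in> V" unfolding v_def using cYX T Y sub by (intro insert_p_in_V) auto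
  \<comment> \<open>Otherwise \<open>Y - X\<close>, with \<open>r - 1\<close> elements, would lie in
    \<open>Y \<inter> Z\<close>, which has only \<open>r - 2\<close>.\<close>
  have "v \<notin> W\<^sub>2"
  proof
    assume "v \<in> W\<^sub>2"
    then obtain X' where X': "X' \<subseteq> Z" "v = insert p (T \<union> X')" by (auto simp: W\<^sub>2_def)
    have "Y - X \<subseteq> Y \<inter> Z"
    proof
      fix a assume a: "a \<in> Y - X"
      then have "a \<in> insert p (T \<union> X')" using X'(2) by (auto simp: v_def)
      then show "a \<in> Y \<inter> Z" using a X'(1) T Y by auto
    qed
    then have "card (Y - X) \<le> card (Y \<inter> Z)" by (intro card_mono) auto
    then show False using cYX YZ r by simp
  qed
  then have vB: "v \<in> B" using v p_notin_W1[of v] by (auto simp: B_def v_def)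
  have wV: "w \<in> V" using w W1_sub by auto
  have "v \<inter> w = T" using X T Y unfolding v_def by auto
  then have vw: "v \<rightarrow>\<^bsub>G\<^esub> w" using v wV by (intro arc_if_disjoint)
  have "u = w" if u: "u \<in> W\<^sub>1 \<union> W\<^sub>2" and arc: "v \<rightarrow>\<^bsub>G\<^esub> u" for u
  proof (rule ccontr)
    assume "u \<noteq> w"
    have uV: "u \<in> V" and Tu: "T \<subseteq> u" using u W1_sub W2_sub by (auto simp: W\<^sub>1_def W\<^sub>2_def)
    have "\<exists>a. a \<in> v \<inter> u \<and> a \<notin> T"
    proof (cases "u \<in> W\<^sub>2")
      case True
      then show ?thesis using p_in_W2 T by (auto simp: v_def)
    next
      case False
      then obtain X' where X': "X' \<subseteq> Y" "card X' = r" "u = T \<union> X'"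
        using u by (auto simp: W\<^sub>1_def)
      have "\<not> X' \<subseteq> X" using card_subset_eq[OF finX] X X' \<open>u \<noteq> w\<close> by metis
      then show ?thesis using X' T by (auto simp: v_def)
    qed
    then show False using not_arc_if_meets[OF v uV _ Tu] arc by (auto simp: v_def)
  qed
  then have "{u \<in> verts G. v \<rightarrow>\<^bsub>G\<^esub> u \<and> u \<notin> B} = {w}"
    using vw wV w by (auto simp: verts_G B_def)
  then show ?thesis using vB by blast
qed

text \<open>The forcers avoid \<open>p\<close> and can have neighbours in \<open>W\<^sub>1\<close>;
  hence this is the second round, when those are black.\<close>

lemma force_W2:
  assumes w: "w \<in> W\<^sub>2"
  shows "\<exists>v\<in>B \<union> W\<^sub>1. {u \<in> verts G. v \<rightarrow>\<^bsub>G\<^esub> u \<and> u \<notin> B \<union> W\<^sub>1} = {w}"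
proof -
  obtain X where X: "X \<subseteq> Z" "card X = r - 1" "w = insert p (T \<union> X)" using w by (auto simp: W\<^sub>2_def)
  have finX: "finite X" using X finite_sets by (metis finite_subset)
  define v where "v = T \<union> (Z - X)"
  have "card (Z - X) = r" using X Z finX r by (simp add: card_Diff_subset)
  then have v: "v \<in> V" unfolding v_def using T Z sub k by (intro disjoint_union_in_V) auto
  have vB: "v \<in> B \<union> W\<^sub>1" using v p_in_W2[of v] T Z by (auto simp: B_def v_def)
  have wV: "w \<in> V" using w W2_sub by auto
  have "v \<inter> w = T" using X T Z unfolding v_def by auto
  then have vw: "v \<rightarrow>\<^bsub>G\<^esub> w" using v wV by (intro arc_if_disjoint)
  have "u = w" if u: "u \<in> W\<^sub>2" and arc: "v \<rightarrow>\<^bsub>G\<^esub> u" for u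
  proof (rule ccontr)
    assume "u \<noteq> w"
    have uV: "u \<in> V" and Tu: "T \<subseteq> u" using u W2_sub by (auto simp: W\<^sub>2_def)
    obtain X' where X': "X' \<subseteq> Z" "card X' = r - 1" "u = insert p (T \<union> X')"
      using u by (auto simp: W\<^sub>2_def)
    have "\<not> X' \<subseteq> X" using card_subset_eq[OF finX] X X' \<open>u \<noteq> w\<close> by metis
    then have "\<exists>a. a \<in> v \<inter> u \<and> a \<notin> T" using X' T by (auto simp: v_def)
    then show False using not_arc_if_meets[OF v uV _ Tu] arc by (auto simp: v_def)
  qed
  moreover have "w \<notin> B \<union> W\<^sub>1" using w p_in_W2 p_notin_W1 by (auto simp: B_def)
  moreover have "u \<in> W\<^sub>2" if "u \<in> verts G" "u \<notin> B \<union> W\<^sub>1" for u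
    using that unfolding verts_G B_def by blast
  ultimately have "{u \<in> verts G. v \<rightarrow>\<^bsub>G\<^esub> u \<and> u \<notin> B \<union> W\<^sub>1} = {w}"
    using vw wV unfolding verts_G by blast
  then show ?thesis using vB by blast
qed

lemma zero_forcing_B: "zero_forcing_set G B"
proof -
  have "finite W\<^sub>1" "finite W\<^sub>2"
    using W1_sub W2_sub finite_V by (auto intro: finite_subset)
  then have "(force_step G)\<^sup>*\<^sup>* B (B \<union> W\<^sub>1)" "(force_step G)\<^sup>*\<^sup>* (B \<union> W\<^sub>1) (B \<union> W\<^sub>1 \<union> W\<^sub>2)"
    using p_notin_W1 p_in_W2
    by (intro force_steps_Un force_W1 force_W2; force simp: B_def)+
  moreover have "B \<union> W\<^sub>1 \<union> W\<^sub>2 = verts G" using W1_sub W2_sub by (auto simp: B_def verts_G)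
  ultimately show ?thesis by (auto simp: zero_forcing_set_def B_def verts_G)
qed

lemma card_B: "card B = (n choose k) - ((2 * r) choose r)"
proof -
  have "card V = n choose k" using n_subsets[of "{1..n}" k] by (simp add: V_def)
  then show ?thesis unfolding B_def
    using W1_sub W2_sub finite_V card_white
    by (subst card_Diff_subset) (auto intro: finite_subset)
qed

section \<open>Connectedness of the black set\<close>

lemma in_BD:
  assumes "u \<in> B"
  shows "finite u" "card u = k" "u \<subseteq> {1..n}"
  using assms by (auto simp: B_def V_def intro: finite_subset)

lemma in_BI:
  assumes "x \<in> V"
    and "\<not> T \<subseteq> x \<or> p \<notin> x \<and> \<not> x \<subseteq> T \<union> Y \<or> p \<in> x \<and> \<not> x \<subseteq> insert p (T \<union> Z)"
  shows "x \<in> B"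
  using assms T Y by (auto simp: B_def W\<^sub>1_def W\<^sub>2_def)

text \<open>A plain relation, so that facts on \<open>rtrancl\<close> apply;
  \<open>connected_B\<close> transfers the result to reachability in the induced subgraph.\<close>

definition "R = {(u, v). u \<in> B \<and> v \<in> B \<and> u \<rightarrow>\<^bsub>G\<^esub> v}"

lemma sym_R: "sym R"
  by (rule symI) (use arc_G_sym in \<open>auto simp: R_def\<close>)

lemma linked_if_common_neighbour:
  assumes "u \<in> B" "v \<in> B" "x \<in> B" "card (x \<inter> u) = t" "card (x \<inter> v) = t"
  shows "(u, v) \<in> R\<^sup>*"
proof -
  have "(x, u) \<in> R" "(x, v) \<in> R" using assms arc_G tS by (auto simp: R_def B_def)
  then show ?thesis using sym_R by (meson converse_rtrancl_into_rtrancl r_into_rtrancl symD)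
qed

text \<open>The hub is the family of \<open>k\<close>-sets between \<open>D\<close> and
  \<open>E\<close>: every black set is linked to a member, and swaps link the members to each
  other.\<close>

lemma linked_through_hub:
  assumes hub: "\<And>u. u \<in> B \<Longrightarrow> \<exists>u'. D \<subseteq> u' \<and> u' \<subseteq> E \<and> card u' = k \<and> (u, u') \<in> R\<^sup>*"
    and E: "finite E"
    and swap: "\<And>u v. D \<subseteq> u \<Longrightarrow> u \<subseteq> E \<Longrightarrow> D \<subseteq> v \<Longrightarrow> v \<subseteq> E \<Longrightarrow> card u = k \<Longrightarrow> card v = k \<Longrightarrow>
      card (u \<inter> v) = k - 1 \<Longrightarrow> (u, v) \<in> R\<^sup>*"
    and uv: "u \<in> B" "v \<in> B"
  shows "(u, v) \<in> R\<^sup>*"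
proof -
  obtain u' v' where uv': "D \<subseteq> u'" "u' \<subseteq> E" "card u' = k" "(u, u') \<in> R\<^sup>*"
    "D \<subseteq> v'" "v' \<subseteq> E" "card v' = k" "(v, v') \<in> R\<^sup>*" using hub uv by meson
  have "(u', v') \<in> R\<^sup>*" by (rule rtrancl_if_swaps_rtrancl[OF E swap]) (use uv' in auto)
  moreover have "(v', v) \<in> R\<^sup>*" using uv'(8) sym_R by (meson sym_rtrancl symD)
  ultimately show ?thesis using uv'(4) by (meson rtrancl_trans)
qed

text \<open>A common neighbour is built from \<open>t\<close> common elements and \<open>r\<close>
  elements outside \<open>u \<union> v\<close>. Avoiding some \<open>a\<close> in \<open>T\<close>
  makes it black, since every white set contains \<open>T\<close>.\<close>

lemma linked_if_swap:
  assumes t: "t > 0" and uv: "u \<in> B" "v \<in> B" "card (u \<inter> v) = k - 1"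
  shows "(u, v) \<in> R\<^sup>*"
proof -
  obtain a where a: "a \<in> T" using t T by (metis card.empty ex_in_conv less_numeral_extra(3))
  have fin: "finite u" "finite v" and cuv: "card u = k" "card v = k"
    and subuv: "u \<subseteq> {1..n}" "v \<subseteq> {1..n}"
    using uv in_BD by auto
  have "card (u \<union> v) + card (u \<inter> v) = 2 * k" using card_Un_Int[OF fin] cuv by simp
  then have "card (u \<union> v) = k + 1" using uv r k by simp
  then have "card ({1..n} - (u \<union> v)) = n - (k + 1)"
    using fin subuv by (subst card_Diff_subset) auto
  \<comment> \<open>At least \<open>k - 1\<close> elements are left by
    \<open>n \<ge> 2 * k + 1\<close>, and \<open>k - 1 \<ge> r\<close> because
    \<open>t > 0\<close>.\<close>
  then have O: "card ({1..n} - (u \<union> v) - {a}) \<ge> r"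
    using n(2) k t card_Diff1_le diff_card_le_card_Diff[of "{a}" "{1..n} - (u \<union> v)"] by simp
  have "card (u \<inter> v - {a}) \<ge> t"
    using uv(3) r k diff_card_le_card_Diff[of "{a}" "u \<inter> v"] by simp
  then obtain C where C: "C \<subseteq> u \<inter> v - {a}" "card C = t" by (meson obtain_subset_with_card_n)
  obtain O' where O': "O' \<subseteq> {1..n} - (u \<union> v) - {a}" "card O' = r"
    using O by (meson obtain_subset_with_card_n)
  have x: "C \<union> O' \<in> V" using C O' subuv k by (intro disjoint_union_in_V) auto
  have "C \<union> O' \<in> B" using a C O' by (intro in_BI[OF x]) auto
  moreover have "(C \<union> O') \<inter> u = C" "(C \<union> O') \<inter> v = C" using C O' by auto
  ultimately show ?thesis using uv C by (intro linked_if_common_neighbour[of u v "C \<union> O'"]) auto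
qed

text \<open>For \<open>t = 0\<close> a black set disjoint from \<open>u \<union> v\<close> is a
  common neighbour. The element \<open>y\<close> keeps the complement of \<open>u \<union> v\<close>
  from being \<open>Y\<close>, all of whose \<open>r\<close>-subsets are white.\<close>

lemma linked_if_small_union:
  assumes t: "t = 0" and uv: "u \<in> B" "v \<in> B" "card (u \<union> v) \<le> k + 2" and y: "y \<in> Y" "y \<in> u"
  shows "(u, v) \<in> R\<^sup>*"
proof -
  define Q where "Q = {1..n} - (u \<union> v)"
  have T0: "T = {}" using t T by simp
  have rk: "r = k" using t k by simp
  have fin: "finite u" "finite v" and subuv: "u \<subseteq> {1..n}" "v \<subseteq> {1..n}"
    using uv in_BD by auto
  have "card Q = n - card (u \<union> v)"
    using fin subuv unfolding Q_def by (subst card_Diff_subset) auto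
  then have Q: "card Q \<ge> 2 * r - 1" using uv n(1) k t by simp
  have finQ: "finite Q" "Q \<subseteq> {1..n}" by (auto simp: Q_def)
  have "\<exists>x. x \<subseteq> Q \<and> x \<in> B"
  proof (cases "\<exists>q\<in>Q. q \<notin> Y \<and> q \<noteq> p")
    case True
    then obtain q where q: "q \<in> Q" "q \<notin> Y" "q \<noteq> p" by blast
    have "card (Q - {p}) \<ge> r" using Q r diff_card_le_card_Diff[of "{p}" Q] by simp
    then obtain x where x: "{q} \<subseteq> x" "x \<subseteq> Q - {p}" "card x = r"
      using exists_subset_between[of "{q}" r "Q - {p}"] q r finQ by auto
    have "x \<in> V" using x finQ rk by (auto simp: V_def)
    then have "x \<in> B" using x q T0 by (intro in_BI) auto
    then show ?thesis using x by auto
  next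
    case False
    \<comment> \<open>Here \<open>Q\<close> lies in a set of \<open>2 * r - 1\<close> elements, the
      lower bound for its own size, so it equals that set. A subset containing \<open>p\<close> and
      some \<open>q\<close> outside \<open>Z\<close> is then black.\<close>
    then have QY: "Q \<subseteq> insert p (Y - {y})" using y by (auto simp: Q_def)
    have "card (insert p (Y - {y})) = 2 * r - 1" using Y y r by simp
    then have Qeq: "Q = insert p (Y - {y})" using QY Q by (intro card_seteq) auto
    have "card (Y - Z - {y}) > 0"
    proof -
      have "card (Y - Z) = card Y - card (Y \<inter> Z)" by (simp add: card_Diff_subset_Int)
      then have "card (Y - Z) \<ge> 2" using Y YZ r by simp
      then show ?thesis using diff_card_le_card_Diff[of "{y}" "Y - Z"] by simp
    qed
    then obtain q where q: "q \<in> Y" "q \<notin> Z" "q \<noteq> y"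
      by (metis DiffE card_gt_0_iff ex_in_conv insertCI)
    have qp: "q \<noteq> p" using q Y by auto
    have "{p, q} \<subseteq> Q" using Qeq q by auto
    moreover have "card {p, q} \<le> r" using r qp by simp
    ultimately obtain x where x: "{p, q} \<subseteq> x" "x \<subseteq> Q" "card x = r"
      using exists_subset_between[of "{p, q}" r Q] Q r finQ(1) by force
    have "x \<in> V" using x finQ rk by (auto simp: V_def)
    then have "x \<in> B" using x q qp T0 by (intro in_BI) auto
    then show ?thesis using x by auto
  qed
  then obtain x where x: "x \<subseteq> Q" "x \<in> B" by blast
  have "x \<inter> u = {}" "x \<inter> v = {}" using x by (auto simp: Q_def)
  then show ?thesis using x uv t by (intro linked_if_common_neighbour[of u v x]) auto
qed

lemma linked:
  assumes "u \<in> B" "v \<in> B"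
  shows "(u, v) \<in> R\<^sup>*"
proof (cases "t = 0")
  case False
  then obtain a where a: "a \<in> T" using T by fastforce
  have hubB: "x \<in> B" if "x \<subseteq> {1..n} - {a}" "card x = k" for x
    using that a by (intro in_BI) (auto simp: V_def)
  show ?thesis
  \<comment> \<open>The hub consists of the \<open>k\<close>-sets avoiding \<open>a\<close>, all
    black; a set containing \<open>a\<close> enters it by one swap.\<close>
  proof (rule linked_through_hub[where D = "{}" and E = "{1..n} - {a}"])
    fix u assume u: "u \<in> B"
    note uV = in_BD[OF u]
    show "\<exists>u'. {} \<subseteq> u' \<and> u' \<subseteq> {1..n} - {a} \<and> card u' = k \<and> (u, u') \<in> R\<^sup>*"
    proof (cases "a \<in> u")
      case True
      have "\<not> {1..n} \<subseteq> u" using card_mono[OF uV(1), of "{1..n}"] uV(2) n(2) k r by auto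
      then obtain c where c: "c \<in> {1..n}" "c \<notin> u" by blast
      let ?u = "insert c (u - {a})"
      have ca: "c \<noteq> a" using c True by auto
      have u': "?u \<subseteq> {1..n} - {a}" "card ?u = k"
        using c ca uV True card_Suc_Diff1[of u a] by auto
      have "u \<inter> ?u = u - {a}" using c by auto
      then have "card (u \<inter> ?u) = k - 1" using uV True by simp
      then have "(u, ?u) \<in> R\<^sup>*" using False u hubB[OF u'] by (intro linked_if_swap) auto
      then show ?thesis using u' by blast
    qed (use uV in auto)
  next
    fix u v assume "u \<subseteq> {1..n} - {a}" "v \<subseteq> {1..n} - {a}" "card u = k" "card v = k"
      "card (u \<inter> v) = k - 1"
    then show "(u, v) \<in> R\<^sup>*" using False hubB by (intro linked_if_swap) auto
  qed (use assms in auto)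
next
  case True
  then have T0: "T = {}" and rk: "r = k" using T k by auto
  have "\<not> Y \<subseteq> Z" "\<not> Z \<subseteq> Y"
    using YZ Y Z r by (auto simp: Int_absorb1 Int_absorb2)
  then obtain y z where y: "y \<in> Y" "y \<notin> Z" and z: "z \<in> Z" "z \<notin> Y" by blast
  have hubB: "x \<in> B" if "{y, z} \<subseteq> x" "x \<subseteq> {1..n}" "card x = k" for x
    using that y z Y Z T0 by (intro in_BI) (auto simp: V_def)
  show ?thesis
  \<comment> \<open>The hub consists of the \<open>k\<close>-sets containing \<open>y\<close> and
    \<open>z\<close>: without \<open>p\<close> such a set is black because of \<open>z\<close>, with
    \<open>p\<close> because of \<open>y\<close>.\<close>
  proof (rule linked_through_hub[where D = "{y, z}" and E = "{1..n}"])
    fix u assume u: "u \<in> B"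
    note uV = in_BD[OF u]
    have "card {y, z} \<le> k" using r rk by (simp add: card_insert_if)
    moreover have "k \<le> card (u \<union> {y, z})" using uV by (metis card_mono finite.emptyI finite.insertI finite_UnI sup_ge1)
    ultimately obtain u' where u': "{y, z} \<subseteq> u'" "u' \<subseteq> u \<union> {y, z}" "card u' = k"
      using exists_subset_between[of "{y, z}" k "u \<union> {y, z}"] uV by auto
    have u'n: "u' \<subseteq> {1..n}" using u' uV y z sub by auto
    have "u' \<union> u \<subseteq> u \<union> {y, z}" using u' by auto
    then have "card (u' \<union> u) \<le> card (u \<union> {y, z})" using uV by (intro card_mono) auto
    also have "\<dots> \<le> card u + card {y, z}" by (rule card_Un_le)
    also have "\<dots> \<le> k + 2" using uV by (simp add: card_insert_if)
    finally have "(u', u) \<in> R\<^sup>*"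
      using True u hubB[OF u'(1) u'n u'(3)] y u' by (intro linked_if_small_union[of u' u y]) auto
    then have "(u, u') \<in> R\<^sup>*" using sym_R by (meson sym_rtrancl symD)
    then show "\<exists>u'. {y, z} \<subseteq> u' \<and> u' \<subseteq> {1..n} \<and> card u' = k \<and> (u, u') \<in> R\<^sup>*"
      using u' u'n by blast
  next
    fix u v assume uv: "{y, z} \<subseteq> u" "u \<subseteq> {1..n}" "{y, z} \<subseteq> v" "v \<subseteq> {1..n}" "card u = k" "card v = k"
      "card (u \<inter> v) = k - 1"
    have "finite u" "finite v" using uv by (auto intro: finite_subset)
    then have "card (u \<union> v) \<le> k + 2" using card_Un_Int[of u v] uv by simp
    then show "(u, v) \<in> R\<^sup>*" using True uv hubB y by (intro linked_if_small_union[of u v y]) auto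
  qed (use assms in auto)
qed

lemma connected_B: "Digraph_Component.connected (G \<restriction> B)"
proof -
  have "r \<le> card Y" using Y r by simp
  then obtain X where X: "X \<subseteq> Y" "card X = r" by (meson obtain_subset_with_card_n)
  \<comment> \<open>Connectedness includes nonemptiness; the forcer of any set in
    \<open>W\<^sub>1\<close> is black.\<close>
  have "B \<noteq> {}" using force_W1[of "T \<union> X"] X by (auto simp: W\<^sub>1_def)
  moreover have "u \<rightarrow>\<^sup>*\<^bsub>with_proj (mk_symmetric (G \<restriction> B))\<^esub> v" if "(u, v) \<in> R\<^sup>*" "u \<in> B" for u v
    using that
  proof (induction rule: rtrancl_induct)
    case base
    then show ?case by (simp add: reachable_def)
  next
    case (step v w)
    have "(v, w) \<in> parcs (mk_symmetric (G \<restriction> B))" "w \<in> B"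
      using step.hyps(2) by (force simp: R_def parcs_mk_symmetric induce_subgraph_def)+
    then show ?case using step.IH step.prems
      by (auto simp: reachable_def intro: rtrancl_on_into_rtrancl_on)
  qed
  ultimately show ?thesis
    unfolding Digraph_Component.connected_def strongly_connected_def
    using linked by (auto simp: induce_subgraph_def)
qed

section \<open>Isolated vertices and connected zero forcing sets\<close>

lemma two_neighbours:
  assumes v: "v \<in> V"
  shows "\<exists>u1\<in>V. \<exists>u2\<in>V. u1 \<noteq> u2 \<and> v \<rightarrow>\<^bsub>G\<^esub> u1 \<and> v \<rightarrow>\<^bsub>G\<^esub> u2"
proof -
  have vn: "finite v" "card v = k" "v \<subseteq> {1..n}" using v finite_in_V[OF v] by (simp_all add: V_def)
  have "t \<le> card v" using vn k by simp
  then obtain C where C: "C \<subseteq> v" "card C = t" by (meson obtain_subset_with_card_n)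
  have "card ({1..n} - v) = n - k" using vn by (subst card_Diff_subset) auto
  then have "r + 1 \<le> card ({1..n} - v)" using n(2) k by simp
  \<comment> \<open>One element more than a neighbour needs: dropping \<open>a\<close> or
    \<open>b\<close> from \<open>D\<close> gives two different neighbours.\<close>
  then obtain D where D: "D \<subseteq> {1..n} - v" "card D = r + 1" by (meson obtain_subset_with_card_n)
  have finD: "finite D" using D by (auto intro: finite_subset)
  have "\<not> card D \<le> Suc 0" using D r by simp
  then obtain a b where ab: "a \<in> D" "b \<in> D" "a \<noteq> b"
    using card_le_Suc0_iff_eq[OF finD] by blast
  have nb: "C \<union> (D - {d}) \<in> V \<and> v \<rightarrow>\<^bsub>G\<^esub> (C \<union> (D - {d}))" if "d \<in> D" for d
  proof -
    have "card (D - {d}) = r" using that D(2) by simp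
    moreover have "C \<subseteq> {1..n}" "D - {d} \<subseteq> {1..n}" "C \<inter> (D - {d}) = {}"
      using C(1) D(1) vn(3) by blast+
    ultimately have V: "C \<union> (D - {d}) \<in> V"
      using C(2) k by (intro disjoint_union_in_V) simp_all
    have "v \<inter> (C \<union> (D - {d})) = C" using C(1) D(1) by blast
    then show ?thesis using arc_G[OF v V] V C tS by simp
  qed
  have "b \<notin> C" using ab C(1) D(1) by blast
  then have "C \<union> (D - {a}) \<noteq> C \<union> (D - {b})" using ab by blast
  with nb[OF ab(1)] nb[OF ab(2)] show ?thesis
    by (intro bexI[of _ "C \<union> (D - {a})"] bexI[of _ "C \<union> (D - {b})"] conjI) simp_all
qed

text \<open>A single vertex is not zero forcing, as its two white neighbours block any force. So
  there is a second vertex, and the first arc of a path to it gives a neighbour.\<close>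

lemma no_isolated_verts_if_connected:
  assumes zf: "zero_forcing_set G C" and conn: "Digraph_Component.connected (G \<restriction> C)"
  shows "no_isolated_verts (G \<restriction> C)"
  unfolding no_isolated_verts_def
proof
  fix v assume "v \<in> verts (G \<restriction> C)"
  then have v: "v \<in> C" by simp
  have CV: "C \<subseteq> V" and steps: "(force_step G)\<^sup>*\<^sup>* C V"
    using zf by (auto simp: zero_forcing_set_def verts_G)
  have vV: "v \<in> V" using v CV by auto
  obtain u1 u2 where u: "u1 \<in> V" "u2 \<in> V" "u1 \<noteq> u2" "v \<rightarrow>\<^bsub>G\<^esub> u1" "v \<rightarrow>\<^bsub>G\<^esub> u2"
    using two_neighbours[OF vV] by blast
  have irrefl: "u1 \<noteq> v" "u2 \<noteq> v" using u(4,5) by (auto simp: johnson_graph_def)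
  have "C \<noteq> {v}"
  proof
    assume C: "C = {v}"
    from steps show False
    proof (cases rule: converse_rtranclpE)
      case base
      then show False using C u irrefl by auto
    next
      case (step D)
      then obtain w where "{u \<in> V. v \<rightarrow>\<^bsub>G\<^esub> u \<and> u \<notin> {v}} = {w}"
        using C by (auto elim!: force_step.cases)
      then have "u1 = w" "u2 = w" using u irrefl by blast+
      then show False using u(3) by simp
    qed
  qed
  then obtain w where w: "w \<in> C" "w \<noteq> v" using v by blast
  have "v \<rightarrow>\<^sup>*\<^bsub>with_proj (mk_symmetric (G \<restriction> C))\<^esub> w"
    using conn v w unfolding Digraph_Component.connected_def strongly_connected_def by auto
  then obtain c where "(v, c) \<in> parcs (mk_symmetric (G \<restriction> C))"
    unfolding reachable_def using w(2) by (auto elim: converse_rtrancl_on_cases)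
  then have "(v, c) \<in> arcs G \<or> (c, v) \<in> arcs G" and c: "c \<in> C"
    by (auto simp: parcs_mk_symmetric induce_subgraph_def)
  then have "(v, c) \<in> arcs G" using arc_G_sym[of c v] by auto
  then have "v \<rightarrow>\<^bsub>G \<restriction> C\<^esub> c"
    using v c by (force simp: arcs_ends_def arc_to_ends_def induce_subgraph_def)
  then show "\<exists>w\<in>verts (G \<restriction> C). v \<rightarrow>\<^bsub>G \<restriction> C\<^esub> w" using c by auto
qed

end

section \<open>Concrete ground sets and the final bounds\<close>

lemma johnson_construction_exists:
  assumes "r \<ge> 2" "t \<in> S" "\<And>s. s \<in> S \<Longrightarrow> s \<le> t"
    and "n \<ge> t + 3 * r + 1" "n \<ge> 2 * (t + r) + 1"
  shows "johnson_construction n (t + r) t r S {1..t} {t + 2..t + 2 * r}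
    {t + r + 3..t + 3 * r + 1} (t + 1)"
proof -
  \<comment> \<open>The overlap has \<open>r - 2\<close> elements, and the whole configuration fills
    exactly \<open>{1..t + 3 * r + 1}\<close>.\<close>
  have "{t + 2..t + 2 * r} \<inter> {t + r + 3..t + 3 * r + 1} = {t + r + 3..t + 2 * r}"
    using assms(1) by auto
  then show ?thesis
    using assms by unfold_locales auto
qed

theorem theorem4p5:
  fixes n k t :: nat and S :: "nat set"
  assumes "n > 0" and "k > 0"
    and "S \<subseteq> {i. i + 2 \<le> k}" and "S \<noteq> {}"
    and "t = Max S"
    and "n \<ge> max (3 * k - 2 * t + 1) (2 * k + 1)"
  defines "G \<equiv> with_proj (johnson_graph S n k)"
    and "b \<equiv> (n choose k) - ((2 * k - 2 * t) choose (k - t))"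
  shows "(zero_forcing_number G \<le> total_zero_forcing_number G \<and>
          total_zero_forcing_number G \<le> connected_zero_forcing_number G \<and>
          connected_zero_forcing_number G \<le> enat b) \<and>
         (S = {0..t} \<longrightarrow>
          zero_forcing_number G = total_zero_forcing_number G \<and>
          total_zero_forcing_number G = connected_zero_forcing_number G \<and>
          connected_zero_forcing_number G = enat b)"
proof -
  have "finite S" using assms(3) by (rule finite_subset) (auto intro: finite_subset[of _ "{..k}"])
  then have t_in: "t \<in> S" and t_max: "\<And>s. s \<in> S \<Longrightarrow> s \<le> t" using assms(4,5) by auto
  have tk: "t + 2 \<le> k" using t_in assms(3) by auto
  define r where "r = k - t"
  have r2: "r \<ge> 2" and kr: "k = t + r" using tk by (auto simp: r_def)
  have diffs: "k - t = r" "2 * k - 2 * t = 2 * r" using kr by auto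
  \<comment> \<open>With \<open>k = t + r\<close>, the bound \<open>3 * k - 2 * t + 1\<close> is
    \<open>t + 3 * r + 1\<close>.\<close>
  have n_ge: "n \<ge> t + 3 * r + 1" "n \<ge> 2 * (t + r) + 1" using assms(6) kr by auto
  interpret J: johnson_construction n k t r S "{1..t}" "{t + 2..t + 2 * r}"
    "{t + r + 3..t + 3 * r + 1}" "t + 1"
    unfolding kr by (rule johnson_construction_exists[OF r2 t_in t_max n_ge])
  have le1: "zero_forcing_number G \<le> total_zero_forcing_number G"
    unfolding zero_forcing_number_def total_zero_forcing_number_def
    by (rule INF_superset_mono) auto
  have le2: "total_zero_forcing_number G \<le> connected_zero_forcing_number G"
    unfolding total_zero_forcing_number_def connected_zero_forcing_number_def G_def
    by (rule INF_superset_mono) (auto intro: J.no_isolated_verts_if_connected)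
  have "connected_zero_forcing_number G \<le> enat (card J.B)"
    unfolding connected_zero_forcing_number_def G_def
    by (rule INF_lower) (use J.zero_forcing_B J.connected_B in blast)
  then have le3: "connected_zero_forcing_number G \<le> enat b"
    unfolding J.card_B b_def diffs .
  show ?thesis
  proof (intro conjI impI)
    assume S: "S = {0..t}"
    have "enat b \<le> zero_forcing_number G"
      unfolding zero_forcing_number_def
    proof (rule INF_greatest)
      fix C assume "C \<in> {C. zero_forcing_set G C}"
      then have "zero_forcing_set (with_proj (johnson_graph {0..t} n k)) C"
        by (simp add: G_def flip: S)
      with tk have "n choose k \<le> card C + ((2 * k - 2 * t) choose (k - t))"
        by (intro card_zero_forcing_set_johnson_ge) auto
      then show "enat b \<le> enat (card C)" by (simp add: b_def)
    qed
    note ge = this order.trans[OF this le1] order.trans[OF order.trans[OF this le1] le2]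
    show "connected_zero_forcing_number G = enat b"
      by (rule order.antisym[OF le3 ge(3)])
    then show "total_zero_forcing_number G = connected_zero_forcing_number G"
      using order.antisym[OF le2] ge(2) by simp
    then show "zero_forcing_number G = total_zero_forcing_number G"
      using order.antisym[OF le1] ge(1) le3 by (metis order.trans)
  qed (fact le1 le2 le3)+
qed

end
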